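(* Let $A\in S^{n\times n}$, $x_0,a,b_1,\ldots,b_m\in\mathbb{R}^n$ and $\gamma,\alpha,\beta_1,\ldots,\beta_m\in\mathbb{R}$. Suppose that there exists $\overline{x}\in\mathbb{R}^n$ with $\|\overline{x}-x_0\|^2<\alpha$ and $b_i^T\overline{x}<\beta_i$, $i=1,\ldots,m$, and that ${\rm dim}\,{\rm Ker}(A-\lambda_{\min}(A)I_n)\ge s+1$, where $s={\rm dim}\,{\rm span}\{b_1,\ldots,b_m\}$. Then the following statements are equivalent: (1) For every $x\in\mathbb{R}^n$: if $\|x-x_0\|^2-\alpha\le 0$ and $b_i^Tx-\beta_i\le 0$, $i=1,\ldots,m$, then $x^TAx+a^Tx+\gamma\ge 0$. (2) There exist $\lambda_i\ge 0$, $i=0,1,\ldots,m$, such that for all $x\in\mathbb{R}^n$, $$(x^TAx+a^Tx+\gamma)+\lambda_0(\|x-x_0\|^2-\alpha)+\sum_{i=1}^m\lambda_i(b_i^Tx-\beta_i)\ge 0.$$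
   Context: $S^{n\times n}$ is the space of real symmetric $n\times n$ matrices, $\lambda_{\min}(A)$ is the smallest eigenvalue of $A$, ${\rm Ker}(M)=\{d: Md=0\}$, and $\|\cdot\|$ is the Euclidean norm. *)

theory Defs
  imports "HOL-Analysis.Analysis"
begin

definition eigenvalues :: "real ^ 'n ^ 'n \<Rightarrow> real set" where
  "eigenvalues A = {c. \<exists>v. v \<noteq> 0 \<and> A *v v = c *\<^sub>R v}"

text \<open>A real symmetric matrix has finitely many eigenvalues and at least one (the index type
  is nonempty), so \<^const>\<open>Min\<close> is applied to a finite nonempty set in that case. For other
  matrices the set may be empty and the value is unspecified.\<close>

definition lambda_min :: "real ^ 'n ^ 'n \<Rightarrow> real" where
  "lambda_min A = Min (eigenvalues A)"

definition Ker :: "real ^ 'n ^ 'm \<Rightarrow> (real ^ 'n) set" where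
  "Ker M = {d. M *v d = 0}"

end

theory Submission
  imports Defs
begin

text \<open>Write \<open>f\<close> for the quadratic objective. Adding the multiple \<open>max 0 (- lambda_min A)\<close> of the
  ball constraint makes it convex. The result \<open>h\<close> is still nonnegative on the feasible set: by the
  dimension hypothesis there is \<open>d \<noteq> 0\<close> in the lowest eigenspace orthogonal to all \<open>b i\<close>; when
  \<open>lambda_min A < 0\<close>, \<open>h\<close> is affine along \<open>d\<close> and the linear constraints do not change,
  so one can slide to the sphere, where \<open>h = f\<close>, without increasing \<open>h\<close>.
  Convex Lagrange duality under the Slater condition then applies to \<open>h\<close>.\<close>

section \<open>Convex Lagrange duality\<close>

text \<open>A multiplier has to lie above \<open>- h x / g x\<close> wherever \<open>g x > 0\<close>
  and below \<open>h y / (- g y)\<close> wherever \<open>g y < 0\<close>. Convexity along a segment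
  crossing \<open>g = 0\<close> puts every lower bound below every upper bound, so the infimum
  \<open>Inf R\<close> of the upper bounds works; the Slater point makes \<open>R\<close>
  nonempty.\<close>

lemma lagrange_multiplier_single:
  fixes h g :: "'a::real_vector \<Rightarrow> real"
  assumes h: "convex_on S h" and g: "convex_on S g"
    and slater: "y0 \<in> S" "g y0 < 0"
    and nonneg: "\<And>x. x \<in> S \<Longrightarrow> g x \<le> 0 \<Longrightarrow> h x \<ge> 0"
  shows "\<exists>l\<ge>0. \<forall>x\<in>S. h x + l * g x \<ge> 0"
proof -
  define R where "R = (\<lambda>y. h y / (- g y)) ` {y \<in> S. g y < 0}"
  have ne: "R \<noteq> {}"
    using slater by (auto simp: R_def)
  have R_nonneg: "r \<ge> 0" if "r \<in> R" for r
    using that nonneg by (force simp: R_def intro!: divide_nonneg_nonpos)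
  then have bdd: "bdd_below R"
    by (meson bdd_belowI)
  have cross: "- h x / g x \<le> h y / (- g y)" if "x \<in> S" "g x > 0" "y \<in> S" "g y < 0" for x y
  proof -
    \<comment> \<open>The weight at which the chord of \<open>g\<close> from \<open>x\<close> to
      \<open>y\<close> vanishes, so that convexity forces \<open>g z \<le> 0\<close> and hence
      \<open>h z \<ge> 0\<close>.\<close>
    define t where "t = g x / (g x - g y)"
    have t: "0 \<le> t" "t \<le> 1" "1 - t = - g y / (g x - g y)"
      using that by (auto simp: t_def field_simps)
    define z where "z = (1 - t) *\<^sub>R x + t *\<^sub>R y"
    have "z \<in> S"
      using convex_on_imp_convex[OF h] that(1,3) t(1,2) unfolding z_def by (rule convexD_alt)
    moreover have "g z \<le> (1 - t) * g x + t * g y"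
      unfolding z_def using convex_onD[OF g] that t by blast
    moreover have "(1 - t) * g x + t * g y = 0"
      using that by (simp add: t(3)) (simp add: t_def field_simps)
    ultimately have "0 \<le> h z"
      using nonneg by simp
    also have "h z \<le> (1 - t) * h x + t * h y"
      unfolding z_def using convex_onD[OF h] that t by blast
    also have "\<dots> = (- g y * h x + g x * h y) / (g x - g y)"
      unfolding t(3) by (simp add: t_def add_divide_distrib diff_divide_distrib)
    finally have "- g y * h x + g x * h y \<ge> 0"
      using that by (simp add: zero_le_divide_iff)
    then show ?thesis
      using that by (simp add: field_simps)
  qed
  have "h x + Inf R * g x \<ge> 0" if "x \<in> S" for x
  proof (cases "g x" "0::real" rule: linorder_cases)
    case less
    then have "Inf R \<le> h x / (- g x)"
      using that by (intro cInf_lower bdd) (auto simp: R_def)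
    then show ?thesis
      using less by (simp add: field_simps)
  next
    case equal
    then show ?thesis
      using nonneg that by simp
  next
    case greater
    have "- h x / g x \<le> Inf R"
      using ne by (rule cInf_greatest) (use cross[OF that greater] in \<open>auto simp: R_def\<close>)
    then show ?thesis
      using greater by (simp add: field_simps)
  qed
  moreover have "Inf R \<ge> 0"
    using ne R_nonneg by (rule cInf_greatest)
  ultimately show ?thesis
    by blast
qed

text \<open>Constraints are moved into the objective one at a time. Constraint \<open>j\<close> is
  priced on the convex set \<open>S\<close> cut out by the others; the new objective
  \<open>h + k * g j\<close> is convex and nonnegative on \<open>S\<close>, so the induction
  hypothesis, general in \<open>h\<close>, handles the rest.\<close>

lemma lagrange_multipliers:
  fixes h :: "'a::real_vector \<Rightarrow> real" and g :: "'i \<Rightarrow> 'a \<Rightarrow> real"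
  assumes "finite I" and "convex_on UNIV h" and "\<And>i. i \<in> I \<Longrightarrow> convex_on UNIV (g i)"
    and "\<And>i. i \<in> I \<Longrightarrow> g i y0 < 0"
    and "\<And>x. (\<And>i. i \<in> I \<Longrightarrow> g i x \<le> 0) \<Longrightarrow> h x \<ge> 0"
  shows "\<exists>l. (\<forall>i\<in>I. l i \<ge> 0) \<and> (\<forall>x. h x + (\<Sum>i\<in>I. l i * g i x) \<ge> 0)"
  using assms
proof (induction I arbitrary: h rule: finite_induct)
  case empty
  then show ?case by simp
next
  case (insert j I)
  define S where "S = (\<Inter>i\<in>I. {x. g i x \<le> 0})"
  have "convex {x. g i x \<le> 0}" if "i \<in> I" for i
  proof (rule convexI)
    fix x y u v
    assume "x \<in> {x. g i x \<le> 0}" "y \<in> {x. g i x \<le> 0}" "0 \<le> u" "0 \<le> v" "u + v = (1::real)"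
    then show "u *\<^sub>R x + v *\<^sub>R y \<in> {x. g i x \<le> 0}"
      using convex_lower[of UNIV "g i" x y u v] insert.prems(2)[of i] that by simp
  qed
  then have "convex S"
    unfolding S_def by (rule convex_INT)
  then have "convex_on S h" "convex_on S (g j)"
    using insert.prems(1,2) by (auto intro: convex_on_subset)
  moreover have "y0 \<in> S" "g j y0 < 0"
    using insert.prems(3) by (auto simp: S_def less_imp_le)
  moreover have "h x \<ge> 0" if "x \<in> S" "g j x \<le> 0" for x
    using that by (intro insert.prems(4)) (auto simp: S_def)
  ultimately obtain k where k: "k \<ge> 0" "\<And>x. x \<in> S \<Longrightarrow> h x + k * g j x \<ge> 0"
    using lagrange_multiplier_single by metis
  have "\<exists>l. (\<forall>i\<in>I. l i \<ge> 0) \<and> (\<forall>x. (h x + k * g j x) + (\<Sum>i\<in>I. l i * g i x) \<ge> 0)"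
  proof (rule insert.IH)
    show "convex_on UNIV (\<lambda>x. h x + k * g j x)"
      using insert.prems(1,2) k(1) by (intro convex_on_add convex_on_cmul) auto
  qed (use insert.prems k(2) in \<open>auto simp: S_def\<close>)
  then obtain l where l: "\<forall>i\<in>I. l i \<ge> 0" "\<And>x. (h x + k * g j x) + (\<Sum>i\<in>I. l i * g i x) \<ge> 0"
    by blast
  have "(\<Sum>i\<in>insert j I. (l(j := k)) i * g i x) = k * g j x + (\<Sum>i\<in>I. l i * g i x)" for x
    using insert.hyps by (auto simp: intro!: sum.cong)
  then show ?case
    using l k(1) by (intro exI[of _ "l(j := k)"]) (auto simp: add.assoc)
qed

section \<open>The smallest eigenvalue\<close>

lemma symmetric_inner:
  fixes A :: "real ^ 'n ^ 'n"
  assumes "transpose A = A"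
  shows "x \<bullet> (A *v y) = y \<bullet> (A *v x)"
  by (metis assms dot_lmul_matrix inner_commute transpose_matrix_vector)

text \<open>Eigenvectors for distinct eigenvalues are orthogonal, hence independent, and an
  independent set is finite. This makes the \<open>Min\<close> in \<open>lambda_min\<close> a lower
  bound for the eigenvalues.\<close>

lemma finite_eigenvalues:
  fixes A :: "real ^ 'n ^ 'n"
  assumes "transpose A = A"
  shows "finite (eigenvalues A)"
proof -
  obtain v where v: "\<And>c. c \<in> eigenvalues A \<Longrightarrow> v c \<noteq> 0 \<and> A *v v c = c *\<^sub>R v c"
    using bchoice[of "eigenvalues A" "\<lambda>c v. v \<noteq> 0 \<and> A *v v = c *\<^sub>R v"]
    by (auto simp: eigenvalues_def)
  have orth: "v c \<bullet> v c' = 0" if "c \<in> eigenvalues A" "c' \<in> eigenvalues A" "c \<noteq> c'" for c c'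
    using symmetric_inner[OF assms, of "v c" "v c'"] v that
    by (simp add: inner_commute)
  have "inj_on v (eigenvalues A)"
    by (rule inj_onI) (metis orth v inner_eq_zero_iff)
  moreover have "pairwise orthogonal (v ` eigenvalues A)"
    using orth by (auto simp: pairwise_def orthogonal_def)
  then have "finite (v ` eigenvalues A)"
    by (metis pairwise_orthogonal_independent independent_imp_finite v imageE)
  ultimately show ?thesis
    by (rule finite_imageD[rotated])
qed

lemma linear_coeff_zero_of_quadratic_nonneg:
  fixes p q :: real
  assumes "\<And>t. 2 * t * p + t\<^sup>2 * q \<ge> 0"
  shows "p = 0"
proof (rule ccontr)
  assume "p \<noteq> 0"
  \<comment> \<open>Opposite in sign to \<open>p\<close> and so small that the quadratic term is at
    most \<open>- t * p\<close>, which leaves at most \<open>t * p < 0\<close> of the whole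
    expression.\<close>
  define t where "t = - p / (\<bar>q\<bar> + 1)"
  have "t\<^sup>2 * q \<le> t\<^sup>2 * (\<bar>q\<bar> + 1)"
    by (intro mult_left_mono) auto
  also have "\<dots> = - t * p"
    by (simp add: t_def power2_eq_square)
  finally have "t * p \<ge> 0"
    using assms[of t] by linarith
  moreover have "t * p = - (p\<^sup>2 / (\<bar>q\<bar> + 1))"
    by (simp add: t_def power2_eq_square)
  moreover have "p\<^sup>2 / (\<bar>q\<bar> + 1) > 0"
    using \<open>p \<noteq> 0\<close> by (intro divide_pos_pos) auto
  ultimately show False
    by linarith
qed

text \<open>A minimizer \<open>u\<close> of the quadratic form on the unit sphere exists by
  compactness and is an eigenvector by first-order optimality. The minimum \<mu> is therefore an
  eigenvalue, so it is at least \<open>lambda_min A\<close>.\<close>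

lemma lambda_min_le_rayleigh:
  fixes A :: "real ^ 'n ^ 'n"
  assumes "transpose A = A"
  shows "lambda_min A * (x \<bullet> x) \<le> x \<bullet> (A *v x)"
proof -
  have "continuous_on (sphere 0 1) (\<lambda>x. x \<bullet> (A *v x))"
    by (intro continuous_intros linear_continuous_on matrix_vector_mul_bounded_linear)
  then obtain u where u: "norm u = 1" and min: "\<And>x. norm x = 1 \<Longrightarrow> u \<bullet> (A *v u) \<le> x \<bullet> (A *v x)"
    using continuous_attains_inf[of "sphere 0 1 :: (real ^ 'n) set" "\<lambda>x. x \<bullet> (A *v x)"] by auto
  define \<mu> where "\<mu> = u \<bullet> (A *v u)"
  have ray: "\<mu> * (x \<bullet> x) \<le> x \<bullet> (A *v x)" for x
  proof (cases "x = 0")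
    case False
    have "\<mu> \<le> (x /\<^sub>R norm x) \<bullet> (A *v (x /\<^sub>R norm x))"
      unfolding \<mu>_def using False by (intro min) simp
    also have "\<dots> = (x \<bullet> (A *v x)) / (x \<bullet> x)"
      by (simp add: matrix_vector_mult_scaleR dot_square_norm power2_eq_square divide_simps)
    finally show ?thesis
      using False by (simp add: field_simps)
  qed simp
  have uu: "u \<bullet> u = 1"
    using u by (simp add: dot_square_norm)
  \<comment> \<open>The form of \<open>A - \<mu> I\<close> is nonnegative and vanishes at
    \<open>u\<close>, so its derivative at \<open>u\<close> is zero in every direction
    \<open>w\<close>.\<close>
  have "w \<bullet> (A *v u - \<mu> *\<^sub>R u) = 0" for w
  proof (rule linear_coeff_zero_of_quadratic_nonneg)
    fix t
    have "0 \<le> (u + t *\<^sub>R w) \<bullet> (A *v (u + t *\<^sub>R w)) - \<mu> * ((u + t *\<^sub>R w) \<bullet> (u + t *\<^sub>R w))"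
      using ray[of "u + t *\<^sub>R w"] by simp
    also have "\<dots> = 2 * t * (w \<bullet> (A *v u - \<mu> *\<^sub>R u)) + t\<^sup>2 * (w \<bullet> (A *v w) - \<mu> * (w \<bullet> w))"
      using symmetric_inner[OF assms, of u w] uu
      by (simp add: matrix_vector_right_distrib matrix_vector_mult_scaleR inner_add_left
          inner_add_right inner_diff_right \<mu>_def[symmetric] inner_commute[of u w] power2_eq_square
          algebra_simps)
    finally show "0 \<le> 2 * t * (w \<bullet> (A *v u - \<mu> *\<^sub>R u)) + t\<^sup>2 * (w \<bullet> (A *v w) - \<mu> * (w \<bullet> w))" .
  qed
  then have "A *v u = \<mu> *\<^sub>R u"
    by (metis inner_eq_zero_iff right_minus_eq)
  moreover have "u \<noteq> 0"
    using u by auto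
  ultimately have "\<mu> \<in> eigenvalues A"
    by (auto simp: eigenvalues_def)
  then have "lambda_min A \<le> \<mu>"
    unfolding lambda_min_def by (intro Min_le finite_eigenvalues assms)
  then show ?thesis
    using ray[of x] mult_right_mono[of "lambda_min A" \<mu> "x \<bullet> x"] by simp
qed

section \<open>Quadratic functions and the duality theorem\<close>

text \<open>The convexity gap on a segment is \<open>u * (1 - u)\<close> times the form of
  \<open>A + t I\<close> at \<open>x - y\<close>. The shift \<open>t\<close> is kept general so that
  the objective, the ball constraint and the linear constraints are all instances.\<close>

lemma convex_on_quadratic:
  fixes A :: "real ^ 'n ^ 'n"
  assumes sym: "transpose A = A" and psd: "\<And>x. x \<bullet> (A *v x) + t * (x \<bullet> x) \<ge> 0"
  shows "convex_on UNIV (\<lambda>x. x \<bullet> (A *v x) + a \<bullet> x + \<gamma> + t * ((norm (x - x0))\<^sup>2 - \<alpha>))"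
proof (rule convex_onI)
  fix u :: real and x y :: "real ^ 'n"
  assume u: "0 < u" "u < 1"
  let ?h = "\<lambda>x. x \<bullet> (A *v x) + a \<bullet> x + \<gamma> + t * ((norm (x - x0))\<^sup>2 - \<alpha>)"
  have "(1 - u) * ?h x + u * ?h y - ?h ((1 - u) *\<^sub>R x + u *\<^sub>R y)
      = u * (1 - u) * ((x - y) \<bullet> (A *v (x - y)) + t * ((x - y) \<bullet> (x - y)))"
    using symmetric_inner[OF sym, of y x]
    by (simp add: power2_norm_eq_inner matrix_vector_right_distrib matrix_vector_mult_diff_distrib
        matrix_vector_mult_scaleR inner_add_left inner_add_right inner_diff_left inner_diff_right
        inner_commute[of y x] inner_commute[of x0 x]
        inner_commute[of x0 y] algebra_simps)
  also have "\<dots> \<ge> 0"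
    using u psd[of "x - y"] by simp
  finally show "?h ((1 - u) *\<^sub>R x + u *\<^sub>R y) \<le> (1 - u) * ?h x + u * ?h y"
    by simp
qed simp

text \<open>The larger root is nonnegative, because \<open>c \<le> 0\<close> makes the square root
  of the discriminant at least \<open>\<bar>q\<bar>\<close>.\<close>

lemma exists_nonneg_quadratic_root:
  fixes p q c :: real
  assumes "p > 0" "c \<le> 0"
  shows "\<exists>t\<ge>0. p * t\<^sup>2 + 2 * q * t + c = 0"
proof -
  define D where "D = q\<^sup>2 - p * c"
  have D: "q\<^sup>2 \<le> D"
    using assms by (simp add: D_def mult_nonneg_nonpos)
  then have "\<bar>q\<bar> \<le> sqrt D"
    by (simp add: real_le_rsqrt)
  moreover have "(sqrt D)\<^sup>2 = D"
    using D by (meson order_trans real_sqrt_pow2 zero_le_power2)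
  then have "p * ((sqrt D - q) / p)\<^sup>2 + 2 * q * ((sqrt D - q) / p) + c = 0"
    using assms by (simp add: field_simps power2_eq_square D_def)
  ultimately show ?thesis
    using assms by (intro exI[of _ "(sqrt D - q) / p"]) auto
qed

text \<open>Along a ray from a point of the ball, squared distance minus \<alpha> is a quadratic in
  \<open>t\<close> with positive leading and nonpositive constant coefficient.\<close>

lemma exists_sphere_point_on_ray:
  fixes x d x0 :: "'a::real_inner"
  assumes "(norm (x - x0))\<^sup>2 \<le> \<alpha>" "d \<noteq> 0"
  shows "\<exists>t\<ge>0. (norm (x + t *\<^sub>R d - x0))\<^sup>2 = \<alpha>"
proof -
  obtain t where "t \<ge> 0" "(d \<bullet> d) * t\<^sup>2 + 2 * (d \<bullet> (x - x0)) * t + ((norm (x - x0))\<^sup>2 - \<alpha>) = 0"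
    using exists_nonneg_quadratic_root[of "d \<bullet> d" "(norm (x - x0))\<^sup>2 - \<alpha>" "d \<bullet> (x - x0)"] assms
    by auto
  moreover have "(norm (x + t *\<^sub>R d - x0))\<^sup>2
      = (d \<bullet> d) * t\<^sup>2 + 2 * (d \<bullet> (x - x0)) * t + (norm (x - x0))\<^sup>2"
    unfolding power2_norm_eq_inner
    by (simp add: inner_diff_left inner_diff_right inner_commute[of x d] inner_commute[of x0 d]
        power2_eq_square algebra_simps)
  ultimately show ?thesis
    by (intro exI[of _ t]) simp
qed

text \<open>Dimension count: the orthogonal complement \<open>W\<close> of \<open>B\<close> has
  codimension \<open>dim B < dim K\<close>, so it meets \<open>K\<close> nontrivially.\<close>

lemma exists_orthogonal_in_subspace:
  fixes K B :: "'a::euclidean_space set"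
  assumes "subspace K" "dim B < dim K"
  shows "\<exists>d\<in>K. d \<noteq> 0 \<and> (\<forall>v\<in>B. v \<bullet> d = 0)"
proof -
  define W where "W = {y \<in> UNIV. \<forall>x\<in>span B. orthogonal x y}"
  have W: "subspace W"
    unfolding W_def by (auto simp: subspace_def orthogonal_clauses)
  have "dim W + dim (span B) = dim (UNIV :: 'a set)"
    unfolding W_def by (intro dim_subspace_orthogonal_to_vectors) auto
  moreover have "dim {x + y |x y. x \<in> K \<and> y \<in> W} + dim (K \<inter> W) = dim K + dim W"
    using assms(1) W by (rule dim_sums_Int)
  moreover have "dim {x + y |x y. x \<in> K \<and> y \<in> W} \<le> dim (UNIV :: 'a set)"
    by (simp add: dim_subset_UNIV)
  ultimately have "dim (K \<inter> W) > 0"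
    using assms(2) unfolding dim_span by linarith
  then have "\<not> K \<inter> W \<subseteq> {0}"
    by (simp flip: dim_eq_0)
  then obtain d where "d \<in> K" "d \<in> W" "d \<noteq> 0"
    by blast
  then show ?thesis
    by (auto simp: W_def orthogonal_def span_base)
qed

lemma subspace_Ker:
  fixes M :: "real ^ 'n ^ 'm"
  shows "subspace (Ker M)"
  by (auto simp: Ker_def subspace_def matrix_vector_right_distrib matrix_vector_mult_scaleR)

text \<open>The quadratic part of \<open>h\<close> is the form of \<open>A - c I\<close>, whose
  kernel contains \<open>d\<close>. Both the square and the cross term in \<open>r\<close> vanish,
  leaving a slope independent of \<open>x\<close>.\<close>

lemma quadratic_along_eigenvector:
  fixes A :: "real ^ 'n ^ 'n"
  assumes sym: "transpose A = A" and d: "A *v d = c *\<^sub>R d"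
    and h: "h = (\<lambda>x. x \<bullet> (A *v x) + a \<bullet> x + \<gamma> - c * ((norm (x - x0))\<^sup>2 - \<alpha>))"
  shows "h (x + r *\<^sub>R d) = h x + r * ((a + (2 * c) *\<^sub>R x0) \<bullet> d)"
  using symmetric_inner[OF sym, of d x] d unfolding h
  by (simp add: power2_norm_eq_inner matrix_vector_right_distrib matrix_vector_mult_scaleR
      inner_add_left inner_add_right inner_diff_left inner_diff_right
      inner_commute[of d x] inner_commute[of d x0] algebra_simps)

theorem corollary4p3:
  fixes A :: "real ^ 'n ^ 'n"
    and x0 a :: "real ^ 'n"
    and m :: nat
    and b :: "nat \<Rightarrow> real ^ 'n"
    and \<gamma> \<alpha> :: real
    and \<beta> :: "nat \<Rightarrow> real"
  assumes symmetric: "transpose A = A"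
    and slater: "\<exists>xbar :: real ^ 'n. (norm (xbar - x0))\<^sup>2 < \<alpha> \<and> (\<forall>i\<in>{1..m}. b i \<bullet> xbar < \<beta> i)"
    and dimension: "dim (Ker (A - lambda_min A *\<^sub>R mat 1)) \<ge> dim (span (b ` {1..m})) + 1"
  shows "(\<forall>x :: real ^ 'n.
            (norm (x - x0))\<^sup>2 - \<alpha> \<le> 0 \<and> (\<forall>i\<in>{1..m}. b i \<bullet> x - \<beta> i \<le> 0)
              \<longrightarrow> x \<bullet> (A *v x) + a \<bullet> x + \<gamma> \<ge> 0)
     \<longleftrightarrow>
         (\<exists>l :: nat \<Rightarrow> real. (\<forall>i\<in>{0..m}. l i \<ge> 0) \<and>
            (\<forall>x :: real ^ 'n.
               (x \<bullet> (A *v x) + a \<bullet> x + \<gamma>) + l 0 * ((norm (x - x0))\<^sup>2 - \<alpha>)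
                 + (\<Sum>i = 1..m. l i * (b i \<bullet> x - \<beta> i)) \<ge> 0))"
  (is "(\<forall>x. ?F x \<longrightarrow> ?f x \<ge> 0) \<longleftrightarrow> ?D")
proof
  assume nonneg: "\<forall>x. ?F x \<longrightarrow> ?f x \<ge> 0"
  define t where "t = max 0 (- lambda_min A)"
  define h where "h = (\<lambda>x. ?f x + t * ((norm (x - x0))\<^sup>2 - \<alpha>))"
  \<comment> \<open>Index 0 carries the ball, so all constraints form one family over
    \<open>{0..m}\<close>.\<close>
  define g where "g = (\<lambda>i x. if i = 0 then (norm (x - x0))\<^sup>2 - \<alpha> else b i \<bullet> x - \<beta> i)"
  obtain xbar where xbar: "(norm (xbar - x0))\<^sup>2 < \<alpha>" "\<forall>i\<in>{1..m}. b i \<bullet> xbar < \<beta> i"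
    using slater by blast
  have h_nonneg: "h x \<ge> 0" if F: "?F x" for x
  proof (cases "lambda_min A \<ge> 0")
    case True
    then show ?thesis
      using nonneg that by (simp add: h_def t_def)
  next
    case False
    then have h_eq: "h = (\<lambda>x. ?f x - lambda_min A * ((norm (x - x0))\<^sup>2 - \<alpha>))"
      by (simp add: h_def t_def)
    have "dim (b ` {1..m}) < dim (Ker (A - lambda_min A *\<^sub>R mat 1))"
      using dimension by simp
    then obtain d where d: "d \<in> Ker (A - lambda_min A *\<^sub>R mat 1)" "d \<noteq> 0"
      and orth: "\<forall>v\<in>b ` {1..m}. v \<bullet> d = 0"
      using exists_orthogonal_in_subspace[OF subspace_Ker] by blast
    have eig: "A *v d = lambda_min A *\<^sub>R d"
      using d(1) by (simp add: Ker_def matrix_vector_mult_diff_rdistrib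
          scaleR_matrix_vector_assoc[symmetric])
    define s where "s = (a + (2 * lambda_min A) *\<^sub>R x0) \<bullet> d"
    \<comment> \<open>The sign is chosen so that \<open>h\<close> has slope
      \<open>- \<bar>s\<bar>\<close> along \<open>e\<close>, whatever the sign of
      \<open>s\<close>.\<close>
    define e where "e = (if s \<le> 0 then d else - d)"
    have "e \<noteq> 0"
      using d(2) by (simp add: e_def)
    then obtain r where r: "r \<ge> 0" "(norm (x + r *\<^sub>R e - x0))\<^sup>2 = \<alpha>"
      using exists_sphere_point_on_ray[of x x0 \<alpha> e] F by auto
    \<comment> \<open>Orthogonality keeps the linear constraints satisfied, so the point reached on
      the sphere is feasible.\<close>
    have "b i \<bullet> (x + r *\<^sub>R e) = b i \<bullet> x" if "i \<in> {1..m}" for i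
      using orth that by (simp add: e_def inner_add_right)
    then have "?f (x + r *\<^sub>R e) \<ge> 0"
      using nonneg F r(2) by simp
    then have "0 \<le> h (x + r *\<^sub>R e)"
      using r(2) by (simp add: h_def)
    also have "\<dots> = h x - r * \<bar>s\<bar>"
      using quadratic_along_eigenvector[OF symmetric eig h_eq, of x r]
        quadratic_along_eigenvector[OF symmetric eig h_eq, of x "- r"]
      by (simp add: e_def s_def)
    also have "\<dots> \<le> h x"
      using r(1) by simp
    finally show ?thesis .
  qed
  have "x \<bullet> (A *v x) + t * (x \<bullet> x) \<ge> 0" for x
    using lambda_min_le_rayleigh[OF symmetric, of x]
      mult_right_mono[of "- lambda_min A" t "x \<bullet> x"] by (simp add: t_def)
  then have "convex_on UNIV h"
    unfolding h_def by (rule convex_on_quadratic[OF symmetric])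
  moreover have "convex_on UNIV (g i)" for i
  proof (cases "i = 0")
    case True
    \<comment> \<open>The zero matrix with shift 1 gives the ball constraint; with shift 0 it gives
      the linear ones below.\<close>
    have "convex_on UNIV (\<lambda>x. x \<bullet> (0 *v x) + 0 \<bullet> x + 0 + 1 * ((norm (x - x0))\<^sup>2 - \<alpha>))"
      by (rule convex_on_quadratic) (auto simp: transpose_def vec_eq_iff)
    then show ?thesis
      using True by (simp add: g_def)
  next
    case False
    have "convex_on UNIV (\<lambda>x. x \<bullet> (0 *v x) + b i \<bullet> x + (- \<beta> i) + 0 * ((norm (x - 0))\<^sup>2 - 0))"
      by (rule convex_on_quadratic) (auto simp: transpose_def vec_eq_iff)
    then show ?thesis
      using False by (simp add: g_def)
  qed
  moreover have "g i xbar < 0" if "i \<in> {0..m}" for i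
    using that xbar by (auto simp: g_def)
  moreover have "h x \<ge> 0" if x: "\<And>i. i \<in> {0..m} \<Longrightarrow> g i x \<le> 0" for x
  proof (rule h_nonneg, intro conjI ballI)
    show "(norm (x - x0))\<^sup>2 - \<alpha> \<le> 0"
      using x[of 0] by (simp add: g_def)
    show "b i \<bullet> x - \<beta> i \<le> 0" if "i \<in> {1..m}" for i
      using x[of i] that by (simp add: g_def)
  qed
  ultimately obtain l where l: "\<forall>i\<in>{0..m}. l i \<ge> 0" "\<And>x. h x + (\<Sum>i\<in>{0..m}. l i * g i x) \<ge> 0"
    using lagrange_multipliers[of "{0..m}" h g xbar] by auto
  \<comment> \<open>\<open>h\<close> already contains \<open>t\<close> copies of the ball
    constraint, which are credited to its multiplier.\<close>
  define l' where "l' = l(0 := l 0 + t)"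
  have "?f x + l' 0 * ((norm (x - x0))\<^sup>2 - \<alpha>) + (\<Sum>i = 1..m. l' i * (b i \<bullet> x - \<beta> i))
      = h x + (\<Sum>i\<in>{0..m}. l i * g i x)" for x
    by (simp add: sum.atLeast_Suc_atMost[of 0] l'_def g_def h_def algebra_simps)
  moreover have "\<forall>i\<in>{0..m}. l' i \<ge> 0"
    using l(1) by (simp add: l'_def t_def)
  ultimately show ?D
    using l(2) by (intro exI[of _ l']) simp
next
  assume ?D
  then obtain l where l: "\<forall>i\<in>{0..m}. l i \<ge> 0"
    and dual: "\<And>x. ?f x + l 0 * ((norm (x - x0))\<^sup>2 - \<alpha>) + (\<Sum>i = 1..m. l i * (b i \<bullet> x - \<beta> i)) \<ge> 0"
    by blast
  show "\<forall>x. ?F x \<longrightarrow> ?f x \<ge> 0"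
  proof (intro allI impI)
    fix x
    assume F: "?F x"
    \<comment> \<open>Weak duality: at a feasible point every multiplier term is nonpositive, so
      dropping them all cannot lower the value.\<close>
    have "l 0 * ((norm (x - x0))\<^sup>2 - \<alpha>) \<le> 0"
      using F l by (simp add: mult_nonneg_nonpos)
    moreover have "(\<Sum>i = 1..m. l i * (b i \<bullet> x - \<beta> i)) \<le> 0"
      using F l by (intro sum_nonpos mult_nonneg_nonpos) auto
    ultimately show "?f x \<ge> 0"
      using dual[of x] by linarith
  qed
qed

end
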